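(* Let $M$ and $N\ge 1$ be real numbers, and let $Q\le M$ and $V\le N/2$ be two positive real parameters, with $Q\ge1$. For each prime $p\le Q$ let $\mathcal{L}_p\subsetneq \mathbb{Z}/p\mathbb{Z}$ be a set of (excluded) residue classes. Let $\mathcal{Z}$ be the set of integers $n\in[M+1,M+N]$ such that, for every prime $p\le Q$, the class of $n$ modulo $p$ does not belong to $\mathcal{L}_p$. Then $$\frac{1-2V/N}{N}\Bigl|\sum_{n\in\mathcal{Z}}1\Bigr|^2\le\int_{-\infty}^\infty\Bigl|\sum_{\substack{n\in\mathcal{Z}\\ |n-t|\le V}}1\Bigr|^2\frac{dt}{4V^2}\le \frac{1+Q^2/V}{L(Q)}\sum_{n\in\mathcal{Z}}1,$$ where $$L(Q)=\sum_{q\le Q}\mu^2(q)\prod_{p\mid q}\frac{|\mathcal{L}_p|}{p-|\mathcal{L}_p|}.$$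
   Context: $\mu$ is the Möbius function; sums over $q$ run over positive integers and products over $p\mid q$ run over primes dividing $q$ (the empty product, for $q=1$, is $1$). *)

theory Defs
  imports "HOL-Analysis.Analysis" "HOL-Number_Theory.Residues"
    "HOL-Computational_Algebra.Squarefree"
begin

definition moebius_mu :: "nat \<Rightarrow> int" where
  "moebius_mu n = (if squarefree n then (-1) ^ card (prime_factors n) else 0)"

text \<open>
  The ring of integers modulo \<open>p\<close> is the library's \<^const>\<open>residue_ring\<close>, whose carrier
  consists of the representatives \<open>0, \<dots>, p - 1\<close>; the class of \<open>n\<close> is \<open>n mod p\<close>.
  The values of \<open>\<L>\<close> outside the primes \<open>p \<le> Q\<close> are irrelevant to both definitions.
\<close>

definition sifted_set :: "(nat \<Rightarrow> int set) \<Rightarrow> real \<Rightarrow> real \<Rightarrow> real \<Rightarrow> int set" where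
  "sifted_set \<L> Q M N =
     {n. real_of_int n \<in> {M + 1..M + N} \<and>
         (\<forall>p. prime p \<and> real p \<le> Q \<longrightarrow> n mod int p \<notin> \<L> p)}"

definition sieve_L :: "(nat \<Rightarrow> int set) \<Rightarrow> real \<Rightarrow> real" where
  "sieve_L \<L> Q =
     (\<Sum>q | 1 \<le> q \<and> real q \<le> Q. real_of_int (moebius_mu q) ^ 2 *
        (\<Prod>p\<in>prime_factors q. real (card (\<L> p)) / (real p - real (card (\<L> p)))))"

end

theory Submission
  imports Defs "HOL-Number_Theory.Totient" "HOL-Library.Real_Mod"
begin

text \<open>
  Expanding the square, the integral is, up to the factor \<open>4 V\<^sup>2\<close>, the Gram sum
  \<open>G(2V) = \<Sum>\<^sub>m\<^sub>,\<^sub>n max 0 (2V - \<bar>m - n\<bar>)\<close> over \<open>m, n \<in> \<Z>\<close>. The lower bound is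
  Cauchy--Schwarz, since the integrand is supported on an interval of length at most \<open>N + 2V\<close>.

  For the upper bound, \<open>G(W)\<close> interpolates linearly between integral \<open>W = H\<close>, where it is the sum of
  the squared cardinalities of the traces of \<open>\<Z>\<close> on all windows of \<open>H\<close> consecutive integers.
  Montgomery's inequality bounds \<open>L(Q)\<close> times each square by the sum of \<open>\<bar>S(a/q)\<bar>\<^sup>2\<close> over
  the Farey fractions of order \<open>Q\<close>, where \<open>S\<close> is the exponential sum of the trace. By Plancherel,
  the sum over all windows turns \<open>S\<close> into the exponential sum of the whole of \<open>\<Z>\<close>, weighted by
  Fejer kernels centred at the Farey fractions. These are \<open>1/Q\<^sup>2\<close>-spaced modulo 1, and the Fejer
  kernel is at most \<open>min (H\<^sup>2, 1/(4 y\<^sup>2))\<close>, so the kernels add up to at most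
  \<open>H\<^sup>2 + (2H - 1) Q\<^sup>2\<close>. Plancherel is used in the finite form modulo a large integer \<open>K\<close>.
\<close>

section \<open>Exponential sums over sifted sets\<close>

definition unit_exp :: "real \<Rightarrow> complex" where
  "unit_exp x = cis (2 * pi * x)"

lemma norm_unit_exp [simp]: "norm (unit_exp x) = 1"
  by (simp add: unit_exp_def)

lemma unit_exp_0 [simp]: "unit_exp 0 = 1"
  by (simp add: unit_exp_def)

lemma unit_exp_add: "unit_exp (x + y) = unit_exp x * unit_exp y"
  by (simp add: unit_exp_def cis_mult distrib_left)

lemma cnj_unit_exp: "cnj (unit_exp x) = unit_exp (- x)"
  by (simp add: unit_exp_def cis_cnj)

lemma unit_exp_power: "unit_exp x ^ n = unit_exp (real n * x)"
  by (simp add: unit_exp_def Complex.DeMoivre mult_ac)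

lemma unit_exp_of_int [simp]: "unit_exp (of_int n) = 1"
  by (simp add: unit_exp_def)

lemma unit_exp_add_of_int [simp]: "unit_exp (x + of_int n) = unit_exp x"
  by (simp add: unit_exp_add)

lemma unit_exp_eq_1_iff: "unit_exp x = 1 \<longleftrightarrow> x \<in> \<int>"
  by (auto simp: unit_exp_def cis_eq_1_iff Ints_def)

lemma unit_exp_cong:
  assumes "x - y \<in> \<int>"
  shows "unit_exp x = unit_exp y"
proof -
  from assms obtain n where "x = y + of_int n"
    by (metis Ints_cases add.commute diff_add_cancel)
  then show ?thesis by simp
qed

lemma sum_unit_exp_multiples:
  fixes K :: nat and d :: int
  assumes "K > 0"
  shows "(\<Sum>j<K. unit_exp (of_int d * real j / real K)) = (if int K dvd d then of_nat K else 0)"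
proof -
  define z where "z = unit_exp (of_int d / real K)"
  have pow: "unit_exp (of_int d * real j / real K) = z ^ j" for j
    by (simp add: z_def unit_exp_power mult_ac)
  have "z = 1 \<longleftrightarrow> int K dvd d"
  proof
    assume "z = 1"
    then obtain m :: int where m: "of_int d / real K = of_int m"
      by (auto simp: z_def unit_exp_eq_1_iff elim: Ints_cases)
    then have "real_of_int d = real_of_int (m * int K)"
      using assms by (simp add: field_simps)
    then have "d = m * int K" by linarith
    then show "int K dvd d" by simp
  next
    assume "int K dvd d"
    then obtain m where "d = int K * m" by blast
    then have "of_int d / real K = of_int m" using assms by simp
    then show "z = 1" by (simp add: z_def)
  qed
  moreover have "z ^ K = 1"
    using assms by (simp add: z_def unit_exp_power)
  ultimately show ?thesis
    by (simp add: pow sum_gp_strict)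
qed

text \<open>Expanding the square and summing over \<open>j\<close> first, orthogonality keeps only
  pairs congruent modulo \<open>K\<close>, which injectivity makes diagonal. Applied with
  \<open>K = p\<close> to residue classes, and with large \<open>K\<close> to window starts and to
  the elements of the set.\<close>

lemma parseval_mod:
  fixes K :: nat and A :: "int set" and c :: "int \<Rightarrow> complex"
  assumes "K > 0" "finite A" and inj: "inj_on (\<lambda>n. n mod int K) A"
  shows "(\<Sum>j<K. norm (\<Sum>n\<in>A. c n * unit_exp (of_int n * (real j / real K)))^2)
       = real K * (\<Sum>n\<in>A. norm (c n)^2)"
proof -
  have "complex_of_real (\<Sum>j<K. norm (\<Sum>n\<in>A. c n * unit_exp (of_int n * (real j / real K)))^2)
      = (\<Sum>j<K. \<Sum>m\<in>A. \<Sum>n\<in>A. c m * cnj (c n) * unit_exp (of_int (m - n) * real j / real K))"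
    unfolding of_real_sum complex_norm_square
    by (intro sum.cong refl)
       (simp add: sum_product cnj_unit_exp mult_ac ring_distribs diff_divide_distrib
          flip: unit_exp_add)
  also have "\<dots> = (\<Sum>m\<in>A. \<Sum>n\<in>A. c m * cnj (c n) * (\<Sum>j<K. unit_exp (of_int (m - n) * real j / real K)))"
    by (subst sum.swap, intro sum.cong refl, subst sum.swap) (simp add: sum_distrib_left)
  also have "\<dots> = (\<Sum>m\<in>A. \<Sum>n\<in>A. if n = m then of_nat K * (c m * cnj (c n)) else 0)"
  proof (intro sum.cong refl)
    fix m n assume "m \<in> A" "n \<in> A"
    then have "int K dvd m - n \<longleftrightarrow> n = m"
      using inj by (auto simp: inj_on_def mod_eq_dvd_iff)
    then show "c m * cnj (c n) * (\<Sum>j<K. unit_exp (of_int (m - n) * real j / real K))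
        = (if n = m then of_nat K * (c m * cnj (c n)) else 0)"
      using sum_unit_exp_multiples[OF \<open>K > 0\<close>, of "m - n"] by auto
  qed
  also have "\<dots> = complex_of_real (real K * (\<Sum>n\<in>A. norm (c n)^2))"
    using \<open>finite A\<close> unfolding of_real_mult of_real_sum complex_norm_square
    by (simp add: sum_distrib_left)
  finally show ?thesis unfolding of_real_eq_iff .
qed

section \<open>Montgomery's inequality for sifted sets\<close>

definition exp_sum :: "int set \<Rightarrow> real \<Rightarrow> complex" where
  "exp_sum A x = (\<Sum>n\<in>A. unit_exp (of_int n * x))"

lemma exp_sum_0 [simp]: "exp_sum A 0 = of_nat (card A)"
  by (simp add: exp_sum_def)

lemma exp_sum_cong:
  assumes "x - y \<in> \<int>"
  shows "exp_sum A x = exp_sum A y"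
proof -
  have "real_of_int n * x - real_of_int n * y \<in> \<int>" for n
    using Ints_mult[OF Ints_of_int assms, of n] by (simp add: right_diff_distrib)
  then show ?thesis
    unfolding exp_sum_def by (intro sum.cong refl unit_exp_cong)
qed

text \<open>Montgomery's inequality at one prime. Cauchy-Schwarz over the \<open>p - card L\<close>
  admissible classes bounds the square at \<open>x\<close> by the energy of the class sums; by
  Parseval, \<open>p\<close> times this energy is the total over all shifts \<open>b / p\<close>.
  The point \<open>x\<close> stays arbitrary so that primes can be combined.\<close>

lemma exp_sum_prime_sieve:
  fixes p :: nat and A L :: "int set" and x :: real
  assumes "p > 0" "finite A" "L \<subset> {0..<int p}" and avoid: "\<And>n. n \<in> A \<Longrightarrow> n mod int p \<notin> L"
  shows "real (card L) / (real p - real (card L)) * norm (exp_sum A x)^2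
       \<le> (\<Sum>b\<in>{1..<p}. norm (exp_sum A (x + real b / real p))^2)"
proof -
  define R where "R = {0..<int p} - L"
  define c where "c h = (\<Sum>n | n \<in> A \<and> n mod int p = h. unit_exp (of_int n * x))" for h
  have fin: "finite R" "finite L" using assms(3) finite_subset by (auto simp: R_def)
  have lt: "card L < p" using psubset_card_mono[OF _ assms(3)] by simp
  have cardR: "real (card R) = real p - real (card L)"
    using assms(3) lt by (auto simp: R_def card_Diff_subset fin of_nat_diff)
  have modR: "(\<lambda>n. n mod int p) ` A \<subseteq> R"
    using avoid \<open>p > 0\<close> by (auto simp: R_def)
  \<comment> \<open>Shifting by \<open>b / p\<close> multiplies all terms of a class
    \<open>h\<close> by the same phase, so the shifted sums are the finite Fourier transform of the
    class sums \<open>c\<close>.\<close>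
  have eq: "exp_sum A (x + real b / real p) = (\<Sum>h\<in>R. c h * unit_exp (of_int h * (real b / real p)))" for b
  proof -
    have "exp_sum A (x + real b / real p)
       = (\<Sum>h\<in>R. \<Sum>n | n \<in> A \<and> n mod int p = h. unit_exp (of_int n * (x + real b / real p)))"
      unfolding exp_sum_def by (rule sum.group[symmetric]) (use fin modR \<open>finite A\<close> in auto)
    also have "\<dots> = (\<Sum>h\<in>R. c h * unit_exp (of_int h * (real b / real p)))"
      unfolding c_def sum_distrib_right
    proof (intro sum.cong refl)
      fix h n assume "n \<in> {n \<in> A. n mod int p = h}"
      then have "n = int p * (n div int p) + h" by auto
      then have "real_of_int n = real p * of_int (n div int p) + of_int h"
        by (metis of_int_add of_int_mult of_int_of_nat_eq)
      then have "real_of_int n * (real b / real p)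
          = of_int h * (real b / real p) + of_int (n div int p * int b)"
        using \<open>p > 0\<close> by (simp add: field_simps)
      then show "unit_exp (of_int n * (x + real b / real p))
          = unit_exp (of_int n * x) * unit_exp (of_int h * (real b / real p))"
        by (simp add: distrib_left unit_exp_add del: of_int_mult)
    qed
    finally show ?thesis .
  qed
  have inj: "inj_on (\<lambda>n. n mod int p) R"
    by (auto simp: inj_on_def R_def)
  have "norm (exp_sum A x)^2 \<le> (\<Sum>h\<in>R. norm (c h))^2"
    using eq[of 0] norm_sum[of c R] by (simp add: power_mono)
  also have "\<dots> \<le> real (card R) * (\<Sum>h\<in>R. norm (c h)^2)"
    using sum_squared_le_sum_of_squares[of "\<lambda>h. norm (c h)" R] by (simp add: mult.commute)
  finally have CS: "norm (exp_sum A x)^2 \<le> real (card R) * (\<Sum>h\<in>R. norm (c h)^2)" .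
  have "(\<Sum>b<p. norm (exp_sum A (x + real b / real p))^2) = real p * (\<Sum>h\<in>R. norm (c h)^2)"
    unfolding eq by (rule parseval_mod[OF \<open>p > 0\<close> fin(1) inj])
  also have "(\<Sum>b<p. norm (exp_sum A (x + real b / real p))^2)
      = norm (exp_sum A x)^2 + (\<Sum>b\<in>{1..<p}. norm (exp_sum A (x + real b / real p))^2)"
    using \<open>p > 0\<close> by (simp add: lessThan_atLeast0 sum.atLeast_Suc_lessThan)
  finally have tot: "(\<Sum>b\<in>{1..<p}. norm (exp_sum A (x + real b / real p))^2)
      = real p * (\<Sum>h\<in>R. norm (c h)^2) - norm (exp_sum A x)^2"
    by linarith
  have pos: "real (card R) > 0" using cardR lt by simp
  have "real p * norm (exp_sum A x)^2 \<le> real p * (real (card R) * (\<Sum>h\<in>R. norm (c h)^2))"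
    using CS by (intro mult_left_mono) auto
  then have "real p / real (card R) * norm (exp_sum A x)^2 \<le> real p * (\<Sum>h\<in>R. norm (c h)^2)"
    using pos by (simp add: field_simps)
  \<comment> \<open>The summand 1 pays for the term \<open>b = 0\<close>, which is missing from the
    sum over \<open>{1..<p}\<close>.\<close>
  moreover have "real p / real (card R) = 1 + real (card L) / real (card R)"
    using cardR pos by (simp add: field_simps)
  ultimately show ?thesis
    unfolding tot cardR[symmetric] by (simp add: algebra_simps)
qed

lemma cong_totatives_imp_eq:
  assumes "u \<in> totatives n" "v \<in> totatives n" "[u = v] (mod n)"
  shows "u = v"
proof (rule ccontr)
  assume "u \<noteq> v"
  have "0 < u" "u \<le> n" "0 < v" "v \<le> n" using assms by (auto simp: in_totatives_iff)
  moreover have "int n dvd int u - int v"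
    using assms(3) by (simp flip: cong_int_iff add: cong_iff_dvd_diff)
  then have "int n \<le> \<bar>int u - int v\<bar>"
    using \<open>u \<noteq> v\<close> zdvd_imp_le[of "int n" "\<bar>int u - int v\<bar>"] by simp
  ultimately show False by linarith
qed

text \<open>This is addition of reduced fractions modulo 1: \<open>u / n + b / m\<close> has
  numerator \<open>m * u + n * b\<close> over \<open>m * n\<close>. For \<open>m * n = 1\<close> the
  remainder would be 0, whereas \<open>totatives 1\<close> is \<open>{1}\<close>.\<close>

lemma totatives_mult_embed:
  fixes m n :: nat
  assumes "coprime m n" "m * n > 1"
  shows "inj_on (\<lambda>(u, b). (m * u + n * b) mod (m * n)) (totatives n \<times> totatives m)"
    and "(\<lambda>(u, b). (m * u + n * b) mod (m * n)) ` (totatives n \<times> totatives m) \<subseteq> totatives (m * n)"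
proof -
  \<comment> \<open>Reduction modulo \<open>n\<close> kills the second summand and leaves
    \<open>m * u\<close> with \<open>m\<close> invertible; exchanging the roles of \<open>m\<close>
    and \<open>n\<close> recovers \<open>b\<close>.\<close>
  have left: "u = u'" if "coprime m n" "u \<in> totatives n" "u' \<in> totatives n"
      "[m * u + n * b = m * u' + n * b'] (mod (m * n))" for m n u u' b b' :: nat
  proof -
    have "[m * u + n * b = m * u' + n * b'] (mod n)"
      using that(4) by (metis cong_modulus_mult_nat mult.commute)
    then have "[m * u = m * u'] (mod n)"
      by (simp add: cong_def)
    then have "[u = u'] (mod n)"
      using that(1) by (simp add: cong_mult_lcancel_nat coprime_commute)
    then show ?thesis using that cong_totatives_imp_eq by blast
  qed
  show "inj_on (\<lambda>(u, b). (m * u + n * b) mod (m * n)) (totatives n \<times> totatives m)"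
  proof (rule inj_onI, clarsimp)
    fix u b u' b'
    assume *: "u \<in> totatives n" "b \<in> totatives m" "u' \<in> totatives n" "b' \<in> totatives m"
      "(m * u + n * b) mod (m * n) = (m * u' + n * b') mod (m * n)"
    then have "[m * u + n * b = m * u' + n * b'] (mod (m * n))"
      by (simp add: cong_def)
    then show "u = u' \<and> b = b'"
      using * left[of m n u u' b b'] left[of n m b b' u u'] \<open>coprime m n\<close>
      by (simp add: add.commute mult.commute coprime_commute)
  qed
  show "(\<lambda>(u, b). (m * u + n * b) mod (m * n)) ` (totatives n \<times> totatives m) \<subseteq> totatives (m * n)"
  proof clarsimp
    fix u b assume *: "u \<in> totatives n" "b \<in> totatives m"
    \<comment> \<open>Modulo \<open>m\<close> only the unit \<open>n * b\<close> survives; exchanged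
      roles treat the other factor.\<close>
    have cop: "coprime (m * u + n * b) m" if "coprime m n" "b \<in> totatives m" for m n u b :: nat
    proof -
      have "gcd m (u * m + n * b) = gcd m (n * b)" by (rule gcd_add_mult)
      then show ?thesis
        using that by (simp add: in_totatives_iff coprime_commute coprime_iff_gcd_eq_1
          gcd.commute mult.commute gcd_mult_right_left_cancel)
    qed
    have "coprime (m * u + n * b) (m * n)"
      using cop[of m n b u] cop[of n m u b] * assms(1)
      by (simp add: coprime_commute add.commute)
    then have "coprime ((m * u + n * b) mod (m * n)) (m * n)"
      using assms(2) by (subst coprime_mod_left_iff) (auto intro: Nat.gr0I)
    moreover from this have "(m * u + n * b) mod (m * n) \<noteq> 0"
      using assms(2) by (metis One_nat_def coprime_0_left_iff less_irrefl nat_dvd_1_iff_1)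
    ultimately show "(m * u + n * b) mod (m * n) \<in> totatives (m * n)"
      using less_imp_le[OF mod_less_divisor[of "m * n" "m * u + n * b"]] assms(2)
      unfolding in_totatives_iff by linarith
  qed
qed

text \<open>One prime is peeled off at a time: with \<open>q = p * r\<close> the induction
  hypothesis handles \<open>r\<close>, and the prime case is applied at each shifted point
  \<open>x + a / r\<close>. The resulting shifts \<open>a / r + b / p\<close> are, modulo 1,
  distinct reduced fractions with denominator \<open>q\<close>.\<close>

lemma exp_sum_squarefree_sieve:
  fixes q :: nat and A :: "int set" and L :: "nat \<Rightarrow> int set" and x :: real
  assumes "finite A" "squarefree q"
    and "\<And>p. p \<in> prime_factors q \<Longrightarrow> L p \<subset> {0..<int p}"
    and "\<And>p n. p \<in> prime_factors q \<Longrightarrow> n \<in> A \<Longrightarrow> n mod int p \<notin> L p"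
  shows "(\<Prod>p\<in>prime_factors q. real (card (L p)) / (real p - real (card (L p)))) * norm (exp_sum A x)^2
       \<le> (\<Sum>a\<in>totatives q. norm (exp_sum A (x + real a / real q))^2)"
  using assms(2-4)
proof (induction q rule: less_induct)
  case (less q)
  define w where "w p = real (card (L p)) / (real p - real (card (L p)))" for p
  have "q > 0" using less.prems(1) by (metis neq0_conv not_squarefree_0)
  show ?case
  proof (cases "q = 1")
    case True
    \<comment> \<open>\<open>totatives 1\<close> is \<open>{1}\<close>, so the only shift is by 1
      and periodicity applies.\<close>
    then show ?thesis
      using exp_sum_cong[of "x + 1" x A] by simp
  next
    case False
    then obtain p where p: "prime p" "p dvd q" using prime_factor_nat by blast
    then obtain r where q: "q = p * r" by blast
    have "r > 0" "p > 1" using \<open>q > 0\<close> q prime_gt_1_nat[OF p(1)] by auto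
    have gt: "p * r > 1" using \<open>p > 1\<close> \<open>r > 0\<close> mult_le_mono[of 2 p 1 r] by linarith
    have "\<not> p dvd r"
    proof
      assume "p dvd r"
      then have "p ^ 2 dvd q" unfolding q power2_eq_square by (rule mult_dvd_mono[OF dvd_refl])
      then have "p dvd 1" using less.prems(1) unfolding squarefree_def by blast
      then show False using \<open>p > 1\<close> by simp
    qed
    then have cop: "coprime p r" using p(1) by (simp add: prime_imp_coprime)
    have pf: "prime_factors q = insert p (prime_factors r)" "p \<notin> prime_factors r"
      using \<open>r > 0\<close> \<open>p > 1\<close> p(1) \<open>\<not> p dvd r\<close>
      by (auto simp: q prime_factors_product prime_prime_factors)
    have Lp: "L p \<subset> {0..<int p}" using less.prems pf by auto
    then have "card (L p) \<le> p" using card_mono[of "{0..<int p}" "L p"] by auto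
    then have w0: "w p \<ge> 0" by (simp add: w_def)
    have "r < q" using q \<open>p > 1\<close> \<open>r > 0\<close> by simp
    have IH: "(\<Prod>p\<in>prime_factors r. w p) * norm (exp_sum A x)^2
       \<le> (\<Sum>a\<in>totatives r. norm (exp_sum A (x + real a / real r))^2)"
      unfolding w_def by (rule less.IH[OF \<open>r < q\<close>]) (use less.prems pf q squarefree_multD in auto)
    have "(\<Prod>p\<in>prime_factors q. w p) * norm (exp_sum A x)^2
        = w p * ((\<Prod>p\<in>prime_factors r. w p) * norm (exp_sum A x)^2)"
      using pf by simp
    also have "\<dots> \<le> (\<Sum>a\<in>totatives r. w p * norm (exp_sum A (x + real a / real r))^2)"
      using mult_left_mono[OF IH w0] by (simp add: sum_distrib_left)
    also have "\<dots> \<le> (\<Sum>a\<in>totatives r. \<Sum>b\<in>totatives p.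
                        norm (exp_sum A (x + real a / real r + real b / real p))^2)"
    proof (rule sum_mono)
      fix a
      have "totatives p = {1..<p}" using p(1) by (auto simp: totatives_prime)
      then show "w p * norm (exp_sum A (x + real a / real r))^2
        \<le> (\<Sum>b\<in>totatives p. norm (exp_sum A (x + real a / real r + real b / real p))^2)"
        unfolding w_def
        using exp_sum_prime_sieve[OF _ \<open>finite A\<close> Lp, of "x + real a / real r"] less.prems pf \<open>p > 1\<close>
        by auto
    qed
    also have "\<dots> = (\<Sum>(a, b)\<in>totatives r \<times> totatives p.
                        norm (exp_sum A (x + real ((p * a + r * b) mod (p * r)) / real q))^2)"
      unfolding sum.cartesian_product
    proof (intro sum.cong refl, clarify)
      fix a b
      define k where "k = (p * a + r * b) div (p * r)"
      have "real (p * a + r * b) = real ((p * r) * k + (p * a + r * b) mod (p * r))"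
        unfolding k_def by (subst mult_div_mod_eq) simp
      then have "real (p * a + r * b) - real ((p * a + r * b) mod (p * r)) = real q * real k"
        by (simp add: q)
      moreover have "real a / real r + real b / real p = real (p * a + r * b) / real q"
        using \<open>r > 0\<close> \<open>p > 1\<close> by (simp add: q field_simps)
      ultimately have "(x + real a / real r + real b / real p)
          - (x + real ((p * a + r * b) mod (p * r)) / real q) = of_int (int k)"
        using \<open>q > 0\<close> by (simp add: field_simps)
      then show "norm (exp_sum A (x + real a / real r + real b / real p))^2
        = norm (exp_sum A (x + real ((p * a + r * b) mod (p * r)) / real q))^2"
        by (subst exp_sum_cong[where y = "x + real ((p * a + r * b) mod (p * r)) / real q"])
           (simp_all only: Ints_of_int)
    qed
    also have "\<dots> = (\<Sum>c\<in>(\<lambda>(a, b). (p * a + r * b) mod (p * r)) ` (totatives r \<times> totatives p).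
                        norm (exp_sum A (x + real c / real q))^2)"
      using totatives_mult_embed(1)[OF cop gt]
      by (subst sum.reindex) (auto simp: q intro!: sum.cong)
    also have "\<dots> \<le> (\<Sum>c\<in>totatives q. norm (exp_sum A (x + real c / real q))^2)"
      using totatives_mult_embed(2)[OF cop gt]
      by (intro sum_mono2) (auto simp: q)
    finally show ?thesis unfolding w_def .
  qed
qed

section \<open>Fejer kernels at spaced points\<close>

text \<open>
  \<open>fejer_primitive H\<close> is the odd primitive of \<open>fejer_majorant H\<close>, written out so that the
  comparison of a sum with an integral becomes a telescoping estimate.
\<close>
definition fejer_majorant :: "real \<Rightarrow> real \<Rightarrow> real" where
  "fejer_majorant H y = (if 2 * H * \<bar>y\<bar> \<le> 1 then H ^ 2 else 1 / (4 * y ^ 2))"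

definition fejer_primitive :: "real \<Rightarrow> real \<Rightarrow> real" where
  "fejer_primitive H y =
    (if 2 * H * \<bar>y\<bar> \<le> 1 then H ^ 2 * y else sgn y * (H - 1 / (4 * \<bar>y\<bar>)))"

lemma fejer_majorant_uminus [simp]: "fejer_majorant H (- y) = fejer_majorant H y"
  by (simp add: fejer_majorant_def)

lemma fejer_primitive_uminus [simp]: "fejer_primitive H (- y) = - fejer_primitive H y"
  by (simp add: fejer_primitive_def sgn_minus)

lemma fejer_majorant_le:
  assumes "H \<ge> 0"
  shows "fejer_majorant H y \<le> H ^ 2"
proof (cases "2 * H * \<bar>y\<bar> \<le> 1")
  case False
  then have "1 ^ 2 \<le> (2 * H * \<bar>y\<bar>) ^ 2" by (intro power_mono) auto
  moreover have "y \<noteq> 0" using False by auto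
  ultimately show ?thesis using False
    by (simp add: fejer_majorant_def field_simps power_mult_distrib)
qed (simp add: fejer_majorant_def)

lemma fejer_majorant_nonneg: "fejer_majorant H y \<ge> 0"
  by (simp add: fejer_majorant_def)

text \<open>The majorant is even and nonincreasing in absolute value, so between \<open>a\<close>
  and \<open>b\<close> it is at least its value at \<open>b\<close>; this is the integrated
  comparison, checked on the explicit formulas.\<close>

lemma fejer_primitive_diff_ge:
  assumes "H > 0" "\<bar>a\<bar> \<le> b"
  shows "(b - a) * fejer_majorant H b \<le> fejer_primitive H b - fejer_primitive H a"
proof (cases "2 * H * b \<le> 1")
  case True
  have "2 * H * \<bar>a\<bar> \<le> 2 * H * b" using assms by simp
  then have "2 * H * \<bar>a\<bar> \<le> 1" using True by linarith
  with True assms show ?thesis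
    by (simp add: fejer_primitive_def fejer_majorant_def algebra_simps)
next
  case False
  have b: "b > 0" using False assms by (cases "b = 0") auto
  \<comment> \<open>Chosen so that \<open>c^2\<close> is the value of the majorant at
    \<open>b\<close>.\<close>
  define c where "c = 1 / (2 * b)"
  have c: "0 < c" "c < H" using b False by (auto simp: c_def field_simps)
  \<comment> \<open>The right side is the line of slope \<open>c^2\<close> through the graph of the
    primitive at \<open>b\<close>, evaluated at \<open>a\<close>.\<close>
  have "fejer_primitive H a \<le> H - c + a * c ^ 2"
  proof (cases "2 * H * \<bar>a\<bar> \<le> 1")
    case True
    have "2 * H * a \<le> 2 * H * \<bar>a\<bar>" using \<open>H > 0\<close> by (intro mult_left_mono) auto
    then have "2 * H * a \<le> 1" using True by linarith
    then have "a * (H^2 - c^2) \<le> 1 / (2 * H) * (H^2 - c^2)"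
      using c \<open>H > 0\<close> by (intro mult_right_mono) (auto simp: field_simps power_mono)
    moreover have "0 \<le> (H - c)^2 / (2 * H)" using \<open>H > 0\<close> by simp
    then have "1 / (2 * H) * (H^2 - c^2) \<le> H - c"
      using \<open>H > 0\<close> by (simp add: field_simps power2_eq_square)
    ultimately show ?thesis using True by (simp add: fejer_primitive_def algebra_simps)
  next
    case far: False
    then have "a \<noteq> 0" by auto
    show ?thesis
    proof (cases "a > 0")
      case True
      have "0 \<le> (1 - 2 * a * c)^2 / (4 * a)" using True by simp
      also have "\<dots> = 1 / (4 * a) - c + a * c^2"
        using True by (simp add: field_simps power2_eq_square)
      finally show ?thesis using True far by (simp add: fejer_primitive_def)
    next
      case neg: False
      define d where "d = - a"
      have d: "0 < d" "d \<le> b" "2 * H * d > 1" using neg far assms \<open>a \<noteq> 0\<close> by (auto simp: d_def)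
      have dc: "2 * d * c \<le> 1" using d by (simp add: c_def)
      have "d * c^2 \<le> c / 2" using mult_right_mono[OF dc, of "c / 2"] c by (simp add: power2_eq_square)
      moreover have "c \<le> 1 / (2 * d)" using d b by (simp add: c_def field_simps)
      moreover have "1 / (2 * d) < H" using d by (simp add: field_simps)
      moreover have "1 / (4 * d) = (1 / (2 * d)) / 2" by simp
      ultimately have "- H + 1 / (4 * d) \<le> H - c - d * c^2" using c by linarith
      moreover have "fejer_primitive H a = - H + 1 / (4 * d)"
        using d far by (simp add: fejer_primitive_def d_def)
      ultimately show ?thesis by (simp add: d_def)
    qed
  qed
  moreover have "fejer_majorant H b = c^2" "fejer_primitive H b = H - c / 2" "b * c^2 = c / 2"
    using False b by (auto simp: fejer_majorant_def fejer_primitive_def c_def power2_eq_square)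
  ultimately show ?thesis by (simp add: left_diff_distrib)
qed

text \<open>Telescoping: \<open>\<delta>\<close> times the value at each point is at most the
  increment of the primitive from its predecessor, the first predecessor being \<open>a\<close>.
  Induction adds the largest point, and \<open>B\<close> varies so that the hypothesis can end at
  the previous one.\<close>

lemma sum_fejer_majorant_right:
  fixes S :: "real set"
  assumes "finite S" "H > 0" "\<delta> > 0"
    and "\<And>s. s \<in> S \<Longrightarrow> \<bar>a\<bar> \<le> s \<and> s \<le> B \<and> a + \<delta> \<le> s" "\<bar>a\<bar> \<le> B"
    and "\<And>s s'. s \<in> S \<Longrightarrow> s' \<in> S \<Longrightarrow> s < s' \<Longrightarrow> s + \<delta> \<le> s'"
  shows "\<delta> * (\<Sum>s\<in>S. fejer_majorant H s) \<le> fejer_primitive H B - fejer_primitive H a"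
  using assms(1,4-6)
proof (induction S arbitrary: B rule: finite_linorder_max_induct)
  case empty
  have "0 \<le> (B - a) * fejer_majorant H B"
    using empty by (intro mult_nonneg_nonneg fejer_majorant_nonneg) auto
  then show ?case using fejer_primitive_diff_ge[OF \<open>H > 0\<close> \<open>\<bar>a\<bar> \<le> B\<close>] by simp
next
  case (insert b S)
  define m where "m = Max (insert a S)"
  have m: "m \<in> insert a S" "\<And>s. s \<in> S \<Longrightarrow> s \<le> m"
    unfolding m_def using insert.hyps(1) Max_in[of "insert a S"] by (auto simp del: Max_insert)
  have am: "a \<le> m" using m insert.prems(1) by force
  have b: "\<bar>a\<bar> \<le> b" "b \<le> B" "a + \<delta> \<le> b" using insert.prems(1)[of b] by auto
  have mb: "m + \<delta> \<le> b"
    using m(1) insert.hyps(2) insert.prems(3)[of _ b] b by auto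
  \<comment> \<open>If \<open>S\<close> is empty, then \<open>m = a\<close>, possibly negative, and
    both sides vanish; otherwise a point of \<open>S\<close> gives
    \<open>\<bar>a\<bar> \<le> m\<close>.\<close>
  have IH: "\<delta> * (\<Sum>s\<in>S. fejer_majorant H s) \<le> fejer_primitive H m - fejer_primitive H a"
  proof (cases "S = {}")
    case True
    then show ?thesis using m by auto
  next
    case False
    then obtain s where "s \<in> S" by auto
    then have "\<bar>a\<bar> \<le> m" using m(2)[of s] insert.prems(1)[of s] by auto
    then show ?thesis
      using insert.prems m(2) by (intro insert.IH) auto
  qed
  have "\<delta> * fejer_majorant H b \<le> (b - m) * fejer_majorant H b"
    using mb by (intro mult_right_mono fejer_majorant_nonneg) auto
  also have "\<dots> \<le> fejer_primitive H b - fejer_primitive H m"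
    using am mb b \<open>\<delta> > 0\<close> by (intro fejer_primitive_diff_ge \<open>H > 0\<close>) auto
  finally have "\<delta> * fejer_majorant H b \<le> fejer_primitive H b - fejer_primitive H m" .
  moreover have "0 \<le> (B - b) * fejer_majorant H B"
    using b by (intro mult_nonneg_nonneg fejer_majorant_nonneg) auto
  then have "fejer_primitive H b \<le> fejer_primitive H B"
    using fejer_primitive_diff_ge[of H b B] \<open>H > 0\<close> b by auto
  moreover have "b \<notin> S" using insert.hyps by auto
  ultimately show ?case
    using IH insert.hyps(1) by (simp add: distrib_left)
qed

text \<open>The point \<open>y0\<close> nearest to 0 costs at most \<open>H ^ 2\<close>. The points
  on its right and the reflected points on its left telescope from \<open>y0\<close> and
  \<open>- y0\<close>; these boundary terms cancel because the primitive is odd, leaving twice its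
  value at \<open>1 / 2\<close>.\<close>

lemma sum_fejer_majorant_spaced:
  fixes Y :: "real set"
  assumes "finite Y" "H \<ge> 1" "\<delta> > 0"
    and half: "\<And>y. y \<in> Y \<Longrightarrow> \<bar>y\<bar> \<le> 1 / 2"
    and spaced: "\<And>y y'. y \<in> Y \<Longrightarrow> y' \<in> Y \<Longrightarrow> y < y' \<Longrightarrow> y + \<delta> \<le> y'"
  shows "(\<Sum>y\<in>Y. fejer_majorant H y) \<le> H ^ 2 + (2 * H - 1) / \<delta>"
proof (cases "Y = {}")
  case True
  then show ?thesis using assms by simp
next
  case False
  define y0 where "y0 = arg_min_on abs Y"
  have y0: "y0 \<in> Y" "\<And>y. y \<in> Y \<Longrightarrow> \<bar>y0\<bar> \<le> \<bar>y\<bar>"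
    unfolding y0_def using arg_min_if_finite[OF \<open>finite Y\<close> False, of abs] arg_min_least[OF \<open>finite Y\<close> False, of _ abs]
    by auto
  define P where "P = {y \<in> Y. y > y0}"
  define M where "M = {y \<in> Y. y < y0}"
  have P1: "\<bar>y0\<bar> \<le> s \<and> s \<le> 1 / 2 \<and> y0 + \<delta> \<le> s" if "s \<in> P" for s
    using that y0(2)[of s] half[of s] spaced[OF y0(1), of s] by (auto simp: P_def abs_if split: if_splits)
  have M1: "\<bar>- y0\<bar> \<le> s \<and> s \<le> 1 / 2 \<and> - y0 + \<delta> \<le> s" if "s \<in> uminus ` M" for s
    using that y0(2)[of "- s"] half[of "- s"] spaced[OF _ y0(1), of "- s"] by (auto simp: M_def abs_if split: if_splits)
  have y0h: "\<bar>y0\<bar> \<le> 1 / 2" using half y0 by auto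
  have right: "\<delta> * (\<Sum>s\<in>P. fejer_majorant H s) \<le> fejer_primitive H (1/2) - fejer_primitive H y0"
    by (rule sum_fejer_majorant_right) (use P1 y0h assms in \<open>auto simp: P_def\<close>)
  have "\<delta> * (\<Sum>s\<in>uminus ` M. fejer_majorant H s) \<le> fejer_primitive H (1/2) - fejer_primitive H (- y0)"
    by (rule sum_fejer_majorant_right) (use M1 y0h assms in \<open>force simp: M_def\<close>)+
  also have "(\<Sum>s\<in>uminus ` M. fejer_majorant H s) = (\<Sum>s\<in>M. fejer_majorant H s)"
    by (simp add: sum.reindex)
  finally have "\<delta> * ((\<Sum>s\<in>M. fejer_majorant H s) + (\<Sum>s\<in>P. fejer_majorant H s)) \<le> 2 * fejer_primitive H (1/2)"
    using right by (simp add: distrib_left)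
  \<comment> \<open>For \<open>H = 1\<close> the point \<open>1/2\<close> falls in the linear
    branch, with the same value.\<close>
  also have "2 * fejer_primitive H (1/2) = 2 * H - 1"
    using \<open>H \<ge> 1\<close> by (cases "H = 1") (auto simp: fejer_primitive_def)
  finally have "(\<Sum>s\<in>M. fejer_majorant H s) + (\<Sum>s\<in>P. fejer_majorant H s) \<le> (2 * H - 1) / \<delta>"
    using \<open>\<delta> > 0\<close> by (simp add: field_simps)
  moreover have "Y = insert y0 (M \<union> P)" using y0 by (auto simp: M_def P_def)
  moreover have "finite M" "finite P" "M \<inter> P = {}" "y0 \<notin> M \<union> P"
    using \<open>finite Y\<close> by (auto simp: M_def P_def)
  ultimately show ?thesis
    using fejer_majorant_le[of H y0] \<open>H \<ge> 1\<close> by (simp add: sum.union_disjoint)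
qed

section \<open>The Fejer kernel and its majorant\<close>

lemma abs_sin_pi_ge:
  assumes "\<bar>y\<bar> \<le> 1 / 2"
  shows "2 * \<bar>y\<bar> \<le> \<bar>sin (pi * y)\<bar>"
proof -
  \<comment> \<open>Jordan's inequality: on \<open>{0..1/2}\<close> the concave function
    \<open>sin (pi * x)\<close> lies above its chord.\<close>
  have conc: "concave_on {0..1/2} (\<lambda>x. sin (pi * x))"
  proof (rule f''_le0_imp_concave)
    fix x :: real assume x: "x \<in> {0..1/2}"
    show "((\<lambda>x. sin (pi * x)) has_real_derivative pi * cos (pi * x)) (at x)"
      by (auto intro!: derivative_eq_intros)
    show "((\<lambda>x. pi * cos (pi * x)) has_real_derivative - (pi^2 * sin (pi * x))) (at x)"
      by (auto intro!: derivative_eq_intros simp: power2_eq_square)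
    have "sin (pi * x) \<ge> 0" using x by (intro sin_ge_zero) (auto simp: field_simps)
    then show "- (pi^2 * sin (pi * x)) \<le> 0" by simp
  qed auto
  define u where "u = \<bar>y\<bar>"
  have u: "0 \<le> u" "u \<le> 1/2" using assms by (auto simp: u_def)
  have "(1 - 2 * u) * sin (pi * 0) + (2 * u) * sin (pi * (1/2))
      \<le> sin (pi * ((1 - 2 * u) *\<^sub>R 0 + (2 * u) *\<^sub>R (1/2)))"
    by (rule concave_onD[OF conc]) (use u in auto)
  then have "2 * u \<le> sin (pi * u)" by simp
  moreover have "\<bar>sin (pi * y)\<bar> = \<bar>sin (pi * u)\<bar>" by (simp add: u_def abs_if)
  ultimately show ?thesis unfolding u_def by linarith
qed

text \<open>Near 0 the trivial bound \<open>H\<close> is used; elsewhere the geometric sum is at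
  most \<open>2 / norm (1 - z)\<close>, where \<open>norm (1 - z)\<close> is a chord of length at
  least \<open>4 * \<bar>y\<bar>\<close>.\<close>

lemma norm_exp_sum_interval_le:
  fixes H :: nat
  assumes "\<bar>y\<bar> \<le> 1 / 2"
  shows "norm (\<Sum>k<H. unit_exp (of_int (int k) * y))^2 \<le> fejer_majorant (real H) y"
proof (cases "2 * real H * \<bar>y\<bar> \<le> 1")
  case True
  have "norm (\<Sum>k<H. unit_exp (of_int (int k) * y)) \<le> real H"
    by (rule order_trans[OF norm_sum]) simp
  then show ?thesis using True by (simp add: fejer_majorant_def power_mono)
next
  case False
  then have "y \<noteq> 0" by auto
  define z where "z = unit_exp y"
  have "norm (1 - z) = norm (exp (\<i> * of_real (2 * pi * y)) - 1)"
    unfolding z_def unit_exp_def cis_conv_exp by (rule norm_minus_commute)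
  also have "\<dots> = 2 * \<bar>sin (pi * y)\<bar>"
    by (simp only: dist_exp_i_1) simp
  finally have "norm (1 - z) = 2 * \<bar>sin (pi * y)\<bar>" .
  then have ge: "4 * \<bar>y\<bar> \<le> norm (1 - z)" using abs_sin_pi_ge[OF assms] by simp
  have "(1 - z) * (\<Sum>k<H. unit_exp (of_int (int k) * y)) = 1 - z ^ H"
    by (simp add: z_def one_diff_power_eq flip: unit_exp_power)
  then have "norm (1 - z) * norm (\<Sum>k<H. unit_exp (of_int (int k) * y)) = norm (1 - z ^ H)"
    by (simp flip: norm_mult)
  also have "\<dots> \<le> 2"
    using norm_triangle_ineq4[of 1 "z ^ H"] by (simp add: z_def norm_power)
  finally have "(4 * \<bar>y\<bar>) * norm (\<Sum>k<H. unit_exp (of_int (int k) * y)) \<le> 2"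
    using mult_right_mono[OF ge] norm_ge_zero order_trans by blast
  then have "norm (\<Sum>k<H. unit_exp (of_int (int k) * y)) \<le> 1 / (2 * \<bar>y\<bar>)"
    using \<open>y \<noteq> 0\<close> by (simp add: field_simps)
  then have "norm (\<Sum>k<H. unit_exp (of_int (int k) * y))^2 \<le> (1 / (2 * \<bar>y\<bar>))^2"
    by (intro power_mono) auto
  then show ?thesis using False by (simp add: fejer_majorant_def power_divide power_mult_distrib)
qed

text \<open>The kernel has period 1, so each argument can be replaced by its representative nearest
  to 0; spacing modulo 1 becomes genuine spacing of the representatives.\<close>

lemma sum_exp_sum_interval_spaced:
  fixes H :: nat and x :: "'r \<Rightarrow> real" and R :: "'r set"
  assumes "finite R" "H \<ge> 1" "\<delta> > 0"
    and spaced: "\<And>r s k. r \<in> R \<Longrightarrow> s \<in> R \<Longrightarrow> r \<noteq> s \<Longrightarrow> \<delta> \<le> \<bar>x r - x s - of_int k\<bar>"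
  shows "(\<Sum>r\<in>R. norm (\<Sum>k<H. unit_exp (of_int (int k) * (\<beta> - x r)))^2)
      \<le> real H ^ 2 + (2 * real H - 1) / \<delta>"
proof -
  define y where "y r = (\<beta> - x r) - of_int (round (\<beta> - x r))" for r
  have half: "\<bar>y r\<bar> \<le> 1 / 2" for r
    unfolding y_def using of_int_round_abs_le[of "\<beta> - x r"] by linarith
  have dist: "\<delta> \<le> \<bar>y r - y s\<bar>" if "r \<in> R" "s \<in> R" "r \<noteq> s" for r s
    using spaced[OF that(2,1), of "round (\<beta> - x r) - round (\<beta> - x s)"] that
    by (simp add: y_def algebra_simps)
  then have inj: "inj_on y R" using \<open>\<delta> > 0\<close> by (force simp: inj_on_def)
  have "norm (\<Sum>k<H. unit_exp (of_int (int k) * (\<beta> - x r)))^2 \<le> fejer_majorant (real H) (y r)" for r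
  proof -
    have "unit_exp (of_int (int k) * (\<beta> - x r)) = unit_exp (of_int (int k) * y r)" for k
      by (rule unit_exp_cong) (simp add: y_def right_diff_distrib)
    then show ?thesis using norm_exp_sum_interval_le[OF half] by simp
  qed
  then have "(\<Sum>r\<in>R. norm (\<Sum>k<H. unit_exp (of_int (int k) * (\<beta> - x r)))^2)
      \<le> (\<Sum>r\<in>R. fejer_majorant (real H) (y r))"
    by (rule sum_mono)
  also have "\<dots> = (\<Sum>z\<in>y ` R. fejer_majorant (real H) z)"
    using inj by (simp add: sum.reindex)
  also have "\<dots> \<le> real H ^ 2 + (2 * real H - 1) / \<delta>"
    using assms(1-3) half dist by (intro sum_fejer_majorant_spaced) (auto, force)
  finally show ?thesis .
qed

section \<open>The large sieve for windows\<close>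

definition int_window :: "int set \<Rightarrow> nat \<Rightarrow> int \<Rightarrow> int set" where
  "int_window A H t = {n \<in> A. t \<le> n \<and> n < t + int H}"

lemma inj_on_mod_interval: "inj_on (\<lambda>n. n mod int K) {c..<c + int K}"
proof (rule inj_onI)
  fix a b
  assume ab: "a \<in> {c..<c + int K}" "b \<in> {c..<c + int K}" "a mod int K = b mod int K"
  then have "int K dvd a - b" by (simp add: mod_eq_dvd_iff)
  moreover have "\<bar>a - b\<bar> < \<bar>int K\<bar>" using ab by auto
  ultimately show "a = b" using dvd_imp_le_int[of "a - b" "int K"] by force
qed

text \<open>The margin \<open>H\<close> on the left keeps the starts of all \<open>H\<close> windows
  containing \<open>n\<close> in the range.\<close>

lemma window_starts:
  assumes "c + int H \<le> n" "n < c + int K"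
  shows "{t \<in> {c..<c + int K}. t \<le> n \<and> n < t + int H} = (\<lambda>k. n - int k) ` {..<H}"
proof (intro equalityI subsetI)
  fix t assume "t \<in> {t \<in> {c..<c + int K}. t \<le> n \<and> n < t + int H}"
  then have "t = n - int (nat (n - t))" "nat (n - t) < H" by auto
  then show "t \<in> (\<lambda>k. n - int k) ` {..<H}" by blast
qed (use assms in auto)

text \<open>As a function of its start \<open>t\<close>, the window sum is a convolution with an
  interval, so its Fourier transform modulo \<open>K\<close> is the full exponential sum times an
  interval kernel. Parseval in \<open>t\<close> gives the identity.\<close>

lemma sum_norm_exp_sum_window:
  fixes A :: "int set" and H K :: nat and c :: int and x :: real
  assumes "K > 0" "A \<subseteq> {c + int H..<c + int K}"
  shows "real K * (\<Sum>t\<in>{c..<c + int K}. norm (exp_sum (int_window A H t) x)^2)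
    = (\<Sum>j<K. norm (exp_sum A (real j / real K))^2 *
        norm (\<Sum>k<H. unit_exp (of_int (int k) * (real j / real K - x)))^2)"
proof -
  let ?T = "{c..<c + int K}"
  have finA: "finite A" using assms(2) finite_subset by blast
  \<comment> \<open>The phase keeps norms and moves the frequency of the kernel from
    \<open>j / K\<close> to \<open>j / K - x\<close>.\<close>
  define f where "f t = exp_sum (int_window A H t) x * unit_exp (- of_int t * x)" for t
  have "real K * (\<Sum>t\<in>?T. norm (exp_sum (int_window A H t) x)^2) = real K * (\<Sum>t\<in>?T. norm (f t)^2)"
    by (simp add: f_def norm_mult)
  also have "\<dots> = (\<Sum>j<K. norm (\<Sum>t\<in>?T. f t * unit_exp (of_int t * (real j / real K)))^2)"
    using parseval_mod[where c = f, OF \<open>K > 0\<close> _ inj_on_mod_interval] by simp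
  also have "\<dots> = (\<Sum>j<K. norm (exp_sum A (real j / real K))^2 *
        norm (\<Sum>k<H. unit_exp (of_int (int k) * (real j / real K - x)))^2)"
  proof (intro sum.cong refl)
    fix j
    define s where "s = real j / real K - x"
    have "(\<Sum>t\<in>?T. f t * unit_exp (of_int t * (real j / real K)))
        = (\<Sum>t\<in>?T. \<Sum>n\<in>A. if t \<le> n \<and> n < t + int H then unit_exp (of_int n * x + of_int t * s) else 0)"
    proof (intro sum.cong refl)
      fix t
      have "f t * unit_exp (of_int t * (real j / real K)) = exp_sum (int_window A H t) x * unit_exp (of_int t * s)"
        by (simp add: f_def s_def algebra_simps flip: unit_exp_add)
      also have "\<dots> = (\<Sum>n\<in>A. if t \<le> n \<and> n < t + int H then unit_exp (of_int n * x + of_int t * s) else 0)"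
        unfolding exp_sum_def int_window_def sum_distrib_right unit_exp_add
        by (rule sum.inter_filter[OF finA])
      finally show "f t * unit_exp (of_int t * (real j / real K)) = \<dots>" .
    qed
    also have "\<dots> = (\<Sum>n\<in>A. \<Sum>t\<in>?T. if t \<le> n \<and> n < t + int H then unit_exp (of_int n * x + of_int t * s) else 0)"
      by (rule sum.swap)
    also have "\<dots> = (\<Sum>n\<in>A. \<Sum>k<H. unit_exp (of_int n * (real j / real K)) * unit_exp (- (of_int (int k) * s)))"
    proof (intro sum.cong refl)
      fix n assume "n \<in> A"
      then have n: "c + int H \<le> n" "n < c + int K" using assms(2) by auto
      have "(\<Sum>t\<in>?T. if t \<le> n \<and> n < t + int H then unit_exp (of_int n * x + of_int t * s) else 0)
          = (\<Sum>t | t \<in> ?T \<and> t \<le> n \<and> n < t + int H. unit_exp (of_int n * x + of_int t * s))"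
        by (rule sum.inter_filter[symmetric]) simp
      also have "\<dots> = (\<Sum>k<H. unit_exp (of_int n * x + of_int (n - int k) * s))"
        unfolding window_starts[OF n] by (subst sum.reindex) (auto simp: inj_on_def)
      \<comment> \<open>Since \<open>x + s = j / K\<close>, each term splits into a factor in
        \<open>n\<close> and a factor in \<open>k\<close>, and the double sum factors.\<close>
      also have "\<dots> = (\<Sum>k<H. unit_exp (of_int n * (real j / real K)) * unit_exp (- (of_int (int k) * s)))"
        by (simp add: s_def algebra_simps diff_divide_distrib flip: unit_exp_add)
      finally show "(\<Sum>t\<in>?T. if t \<le> n \<and> n < t + int H then unit_exp (of_int n * x + of_int t * s) else 0) = \<dots>" .
    qed
    also have "\<dots> = exp_sum A (real j / real K) * cnj (\<Sum>k<H. unit_exp (of_int (int k) * s))"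
      by (simp add: exp_sum_def sum_product cnj_unit_exp)
    finally show "norm (\<Sum>t\<in>?T. f t * unit_exp (of_int t * (real j / real K)))^2
      = norm (exp_sum A (real j / real K))^2 * norm (\<Sum>k<H. unit_exp (of_int (int k) * (real j / real K - x)))^2"
      by (simp add: norm_mult power_mult_distrib s_def del: cnj_sum)
  qed
  finally show ?thesis .
qed

text \<open>After summing the window identity over \<open>r\<close>, the kernels at spaced points
  are bounded uniformly in \<open>j\<close>. What remains is Parseval for the whole set with unit
  coefficients, and \<open>K\<close> cancels.\<close>

lemma large_sieve_windows:
  fixes x :: "'r \<Rightarrow> real" and A :: "int set" and H K :: nat and c :: int
  assumes "finite R" "H \<ge> 1" "\<delta> > 0" "A \<subseteq> {c + int H..<c + int K}" "K > 0"
    and spaced: "\<And>r s k. r \<in> R \<Longrightarrow> s \<in> R \<Longrightarrow> r \<noteq> s \<Longrightarrow> \<delta> \<le> \<bar>x r - x s - of_int k\<bar>"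
  shows "(\<Sum>t\<in>{c..<c + int K}. \<Sum>r\<in>R. norm (exp_sum (int_window A H t) (x r))^2)
     \<le> (real H ^ 2 + (2 * real H - 1) / \<delta>) * real (card A)"
proof -
  let ?D = "\<lambda>y. norm (\<Sum>k<H. unit_exp (of_int (int k) * y))^2"
  define B where "B = real H ^ 2 + (2 * real H - 1) / \<delta>"
  have finA: "finite A" using assms(4) finite_subset by blast
  have "real K * (\<Sum>t\<in>{c..<c + int K}. \<Sum>r\<in>R. norm (exp_sum (int_window A H t) (x r))^2)
    = (\<Sum>r\<in>R. real K * (\<Sum>t\<in>{c..<c + int K}. norm (exp_sum (int_window A H t) (x r))^2))"
    by (subst sum.swap) (simp add: sum_distrib_left)
  also have "\<dots> = (\<Sum>r\<in>R. \<Sum>j<K. norm (exp_sum A (real j / real K))^2 * ?D (real j / real K - x r))"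
    using sum_norm_exp_sum_window[OF \<open>K > 0\<close> assms(4)] by simp
  also have "\<dots> = (\<Sum>j<K. norm (exp_sum A (real j / real K))^2 * (\<Sum>r\<in>R. ?D (real j / real K - x r)))"
    by (subst sum.swap) (simp add: sum_distrib_left)
  also have "\<dots> \<le> (\<Sum>j<K. norm (exp_sum A (real j / real K))^2 * B)"
    unfolding B_def
    by (intro sum_mono mult_left_mono sum_exp_sum_interval_spaced assms) auto
  also have "\<dots> = B * (\<Sum>j<K. norm (\<Sum>n\<in>A. 1 * unit_exp (of_int n * (real j / real K)))^2)"
    by (simp add: exp_sum_def sum_distrib_left mult.commute)
  also have "(\<Sum>j<K. norm (\<Sum>n\<in>A. 1 * unit_exp (of_int n * (real j / real K)))^2) = real K * (\<Sum>n\<in>A. norm (1::complex)^2)"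
    using assms(4) by (intro parseval_mod[OF \<open>K > 0\<close> finA] inj_on_subset[OF inj_on_mod_interval]) force
  finally have "real K * (\<Sum>t\<in>{c..<c + int K}. \<Sum>r\<in>R. norm (exp_sum (int_window A H t) (x r))^2)
     \<le> real K * (B * real (card A))"
    by (simp add: mult_ac)
  then show ?thesis
    using \<open>K > 0\<close> by (simp add: B_def)
qed

section \<open>Farey fractions and the sieve weights\<close>

lemma farey_spaced:
  fixes q q' a a' :: nat and k :: int
  assumes "a \<in> totatives q" "a' \<in> totatives q'" "(q, a) \<noteq> (q', a')" "real q \<le> Q" "real q' \<le> Q"
  shows "1 / Q ^ 2 \<le> \<bar>real a / real q - real a' / real q' - of_int k\<bar>"
proof -
  have q: "q > 0" "q' > 0" using assms by (auto simp: in_totatives_iff)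
  \<comment> \<open>The numerator of the difference over the denominator \<open>q * q'\<close>. A
    nonzero integer is at least 1 in absolute value, and the denominator is at most
    \<open>Q ^ 2\<close>.\<close>
  define d where "d = int a * int q' - int a' * int q - k * int q * int q'"
  have "d \<noteq> 0"
  proof
    assume "d = 0"
    then have eq: "int a * int q' = int q * (int a' + k * int q')" "int a' * int q = int q' * (int a - k * int q)"
      by (auto simp: d_def algebra_simps)
    \<comment> \<open>Coprimality makes the denominators divide each other; equal denominators leave
      congruent, hence equal, numerators.\<close>
    have "int q dvd int a * int q'" "int q' dvd int a' * int q" unfolding eq by auto
    then have "q dvd a * q'" "q' dvd a' * q" by (metis of_nat_dvd_iff of_nat_mult)+
    moreover have "coprime q a" "coprime q' a'"
      using assms(1,2) by (simp_all add: in_totatives_iff coprime_commute)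
    ultimately have "q dvd q'" "q' dvd q" by (simp_all add: coprime_dvd_mult_right_iff)
    then have "q = q'" by (rule dvd_antisym)
    then have "int a = int a' + k * int q" using eq(1) q by simp
    then have "[a = a'] (mod q)" by (simp flip: cong_int_iff add: cong_iff_dvd_diff)
    then show False using cong_totatives_imp_eq assms \<open>q = q'\<close> by blast
  qed
  then have "1 \<le> \<bar>real_of_int d\<bar>" by linarith
  then have "1 / (real q * real q') \<le> \<bar>real_of_int d\<bar> / (real q * real q')"
    using q by (intro divide_right_mono) auto
  also have "\<dots> = \<bar>real_of_int d / (real q * real q')\<bar>" by (simp add: abs_mult)
  also have "real_of_int d / (real q * real q') = real a / real q - real a' / real q' - of_int k"
    using q by (simp add: d_def field_simps)
  finally have "1 / (real q * real q') \<le> \<bar>real a / real q - real a' / real q' - of_int k\<bar>" .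
  moreover have "real q * real q' \<le> Q ^ 2"
    unfolding power2_eq_square using assms by (intro mult_mono) auto
  then have "1 / Q ^ 2 \<le> 1 / (real q * real q')" using q by (intro frac_le) auto
  ultimately show ?thesis by linarith
qed

lemma finite_nat_le_real: "finite {q::nat. 1 \<le> q \<and> real q \<le> Q}"
  by (rule finite_subset[of _ "{..nat \<lfloor>Q\<rfloor>}"]) (auto simp: le_nat_floor)

text \<open>Montgomery's inequality at 0, where the exponential sum counts, is applied to every
  window and every squarefree \<open>q \<le> Q\<close>; the large sieve then applies to the
  resulting Farey fractions with \<open>\<delta> = 1 / Q ^ 2\<close>.\<close>

lemma sieve_windows:
  fixes A :: "int set" and \<L> :: "nat \<Rightarrow> int set" and H K :: nat and c :: int and Q :: real
  assumes "Q \<ge> 1" "H \<ge> 1" "A \<subseteq> {c + int H..<c + int K}" "K > 0"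
    and L: "\<And>p. prime p \<Longrightarrow> real p \<le> Q \<Longrightarrow> \<L> p \<subset> {0..<int p}"
    and avoid: "\<And>p n. prime p \<Longrightarrow> real p \<le> Q \<Longrightarrow> n \<in> A \<Longrightarrow> n mod int p \<notin> \<L> p"
  shows "sieve_L \<L> Q * (\<Sum>t\<in>{c..<c + int K}. real (card (int_window A H t))^2)
      \<le> (real H ^ 2 + (2 * real H - 1) * Q ^ 2) * real (card A)"
proof -
  let ?I = "{q::nat. 1 \<le> q \<and> real q \<le> Q}"
  have finA: "finite A" using assms(3) finite_subset by blast
  have "sieve_L \<L> Q * real (card W)^2 \<le> (\<Sum>(q, a)\<in>Sigma ?I totatives. norm (exp_sum W (real a / real q))^2)"
    if "W \<subseteq> A" for W
  proof -
    define w where "w p = real (card (\<L> p)) / (real p - real (card (\<L> p)))" for p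
    have finW: "finite W" using finA that finite_subset by blast
    have "sieve_L \<L> Q * real (card W)^2
      = (\<Sum>q\<in>?I. real_of_int (moebius_mu q)^2 * ((\<Prod>p\<in>prime_factors q. w p) * norm (exp_sum W 0)^2))"
      by (simp add: sieve_L_def w_def sum_distrib_right mult.assoc)
    also have "\<dots> \<le> (\<Sum>q\<in>?I. \<Sum>a\<in>totatives q. norm (exp_sum W (real a / real q))^2)"
    proof (rule sum_mono)
      fix q assume q: "q \<in> ?I"
      show "real_of_int (moebius_mu q)^2 * ((\<Prod>p\<in>prime_factors q. w p) * norm (exp_sum W 0)^2)
          \<le> (\<Sum>a\<in>totatives q. norm (exp_sum W (real a / real q))^2)"
      proof (cases "squarefree q")
        case False
        then show ?thesis by (simp add: moebius_mu_def sum_nonneg)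
      next
        case True
        have pq: "prime p \<and> real p \<le> Q" if "p \<in> prime_factors q" for p
          using that q dvd_imp_le[of p q] by (auto simp: in_prime_factors_iff)
        have "(\<Prod>p\<in>prime_factors q. w p) * norm (exp_sum W 0)^2
          \<le> (\<Sum>a\<in>totatives q. norm (exp_sum W (0 + real a / real q))^2)"
          unfolding w_def
          by (rule exp_sum_squarefree_sieve[OF finW True]) (use pq L avoid \<open>W \<subseteq> A\<close> in blast)+
        moreover have "real_of_int (moebius_mu q)^2 = 1"
          using True by (simp add: moebius_mu_def flip: power_mult)
        ultimately show ?thesis by simp
      qed
    qed
    also have "\<dots> = (\<Sum>(q, a)\<in>Sigma ?I totatives. norm (exp_sum W (real a / real q))^2)"
      by (rule sum.Sigma) (auto simp: finite_nat_le_real[unfolded One_nat_def])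
    finally show ?thesis .
  qed
  then have "sieve_L \<L> Q * (\<Sum>t\<in>{c..<c + int K}. real (card (int_window A H t))^2)
      \<le> (\<Sum>t\<in>{c..<c + int K}. \<Sum>r\<in>Sigma ?I totatives.
            norm (exp_sum (int_window A H t) (real (snd r) / real (fst r)))^2)"
    unfolding sum_distrib_left by (intro sum_mono) (auto simp: int_window_def case_prod_beta)
  also have "\<dots> \<le> (real H ^ 2 + (2 * real H - 1) / (1 / Q ^ 2)) * real (card A)"
  proof (rule large_sieve_windows[OF _ \<open>H \<ge> 1\<close> _ assms(3) \<open>K > 0\<close>])
    fix r s k assume "r \<in> Sigma ?I totatives" "s \<in> Sigma ?I totatives" "r \<noteq> s"
    then show "1 / Q ^ 2 \<le> \<bar>real (snd r) / real (fst r) - real (snd s) / real (fst s) - of_int k\<bar>"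
      using farey_spaced[of "snd r" "fst r" "snd s" "fst s" Q k] by auto
  qed (use \<open>Q \<ge> 1\<close> in \<open>auto simp: finite_nat_le_real[unfolded One_nat_def]\<close>)
  finally show ?thesis by simp
qed

text \<open>A pair \<open>m\<close>, \<open>n\<close> lies in \<open>H - \<bar>m - n\<bar>\<close>
  common windows, or in none; the margin on the left keeps all their starts in range.\<close>

lemma sum_card_window_squared:
  fixes A :: "int set" and H K :: nat and c :: int
  assumes "A \<subseteq> {c + int H..<c + int K}"
  shows "(\<Sum>t\<in>{c..<c + int K}. real (card (int_window A H t))^2)
      = (\<Sum>m\<in>A. \<Sum>n\<in>A. max 0 (real H - \<bar>real_of_int m - real_of_int n\<bar>))"
proof -
  let ?T = "{c..<c + int K}"
  have finA: "finite A" using assms finite_subset by blast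
  let ?w = "\<lambda>n t. if t \<le> n \<and> n < t + int H then 1 else 0 :: real"
  have "(\<Sum>t\<in>?T. real (card (int_window A H t))^2) = (\<Sum>t\<in>?T. \<Sum>m\<in>A. \<Sum>n\<in>A. ?w m t * ?w n t)"
  proof (intro sum.cong refl)
    fix t
    have "real (card (int_window A H t)) = (\<Sum>n\<in>A. ?w n t)"
      unfolding int_window_def using finA by (simp flip: sum.inter_filter)
    then show "real (card (int_window A H t))^2 = (\<Sum>m\<in>A. \<Sum>n\<in>A. ?w m t * ?w n t)"
      by (simp only: power2_eq_square sum_product)
  qed
  also have "\<dots> = (\<Sum>m\<in>A. \<Sum>n\<in>A. \<Sum>t\<in>?T. ?w m t * ?w n t)"
    by (rule trans[OF sum.swap], intro sum.cong refl sum.swap)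
  also have "\<dots> = (\<Sum>m\<in>A. \<Sum>n\<in>A. max 0 (real H - \<bar>real_of_int m - real_of_int n\<bar>))"
  proof (intro sum.cong refl)
    fix m n assume mn: "m \<in> A" "n \<in> A"
    have "(\<Sum>t\<in>?T. ?w m t * ?w n t) = (\<Sum>t\<in>?T. if max m n - int H < t \<and> t \<le> min m n then 1 else 0)"
      by (intro sum.cong) auto
    also have "\<dots> = real (card {t \<in> ?T. max m n - int H < t \<and> t \<le> min m n})"
      by (simp flip: sum.inter_filter)
    also have "{t \<in> ?T. max m n - int H < t \<and> t \<le> min m n} = {max m n - int H<..min m n}"
      using mn assms by (auto simp: max_def min_def split: if_splits)
    also have "real (card \<dots>) = max 0 (real H - \<bar>real_of_int m - real_of_int n\<bar>)"
      by (auto simp: max_def min_def)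
    finally show "(\<Sum>t\<in>?T. ?w m t * ?w n t) = \<dots>" .
  qed
  finally show ?thesis .
qed

section \<open>Counting in real windows\<close>

abbreviation (input) real_window :: "int set \<Rightarrow> real \<Rightarrow> real \<Rightarrow> int set" where
  "real_window A V t \<equiv> {n. n \<in> A \<and> \<bar>real_of_int n - t\<bar> \<le> V}"

lemma card_real_window:
  assumes "finite A"
  shows "real (card (real_window A V t)) = (\<Sum>n\<in>A. indicat_real {of_int n - V..of_int n + V} t)"
proof -
  have "indicat_real {of_int n - V..of_int n + V} t = (if \<bar>real_of_int n - t\<bar> \<le> V then 1 else 0)" for n
    by (auto simp: indicator_def)
  then show ?thesis using assms by (simp flip: sum.inter_filter)
qed

lemma integral_indicator_Icc:
  "(LBINT t. indicat_real {a..b} t) = max 0 (b - a)"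
  "integrable lborel (indicat_real {a..b})"
  by (auto simp: max_def emeasure_lborel_Icc_eq)

lemma integral_card_real_window:
  assumes "finite A" "V \<ge> 0"
  shows "(LBINT t. real (card (real_window A V t))) = 2 * V * real (card A)"
    and "integrable lborel (\<lambda>t. real (card (real_window A V t)))"
  using assms by (simp_all add: card_real_window Bochner_Integration.integral_sum)

text \<open>The intervals of radius \<open>V\<close> about \<open>m\<close> and \<open>n\<close>
  overlap in length \<open>2 * V - \<bar>m - n\<bar>\<close>, or 0 if this is negative.\<close>

lemma integral_card_real_window_squared:
  assumes "finite A"
  shows "(LBINT t. real (card (real_window A V t))^2)
       = (\<Sum>m\<in>A. \<Sum>n\<in>A. max 0 (2 * V - \<bar>real_of_int m - real_of_int n\<bar>))"
    and "integrable lborel (\<lambda>t. real (card (real_window A V t))^2)"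
proof -
  have eq: "real (card (real_window A V t))^2
     = (\<Sum>m\<in>A. \<Sum>n\<in>A. indicat_real {max (of_int m) (of_int n) - V..min (of_int m) (of_int n) + V} t)" for t
    unfolding card_real_window[OF assms] power2_eq_square sum_product
    by (intro sum.cong refl) (auto simp: indicator_def)
  show "integrable lborel (\<lambda>t. real (card (real_window A V t))^2)"
    unfolding eq by (intro Bochner_Integration.integrable_sum integral_indicator_Icc)
  have "(LBINT t. real (card (real_window A V t))^2)
     = (\<Sum>m\<in>A. \<Sum>n\<in>A. max 0 ((min (of_int m) (of_int n) + V) - (max (of_int m) (of_int n) - V)))"
    unfolding eq
    by (subst Bochner_Integration.integral_sum;
        (intro Bochner_Integration.integrable_sum integral_indicator_Icc sum.cong refl)?)+
  also have "\<dots> = (\<Sum>m\<in>A. \<Sum>n\<in>A. max 0 (2 * V - \<bar>real_of_int m - real_of_int n\<bar>))"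
    by (intro sum.cong refl) (auto simp: max_def min_def)
  finally show "(LBINT t. real (card (real_window A V t))^2)
       = (\<Sum>m\<in>A. \<Sum>n\<in>A. max 0 (2 * V - \<bar>real_of_int m - real_of_int n\<bar>))" .
qed

text \<open>Cauchy-Schwarz on an interval of length \<open>b - a + 2 * V\<close> containing the
  support, obtained by integrating \<open>0 \<le> (f t - \<theta>)^2\<close>.\<close>

lemma integral_card_real_window_squared_ge:
  fixes A :: "int set" and a b V :: real
  assumes "finite A" "V > 0" "a \<le> b" "\<And>n. n \<in> A \<Longrightarrow> real_of_int n \<in> {a..b}"
  shows "(2 * V * real (card A))^2 \<le> (b - a + 2 * V) * (LBINT t. real (card (real_window A V t))^2)"
proof -
  define f where "f t = real (card (real_window A V t))" for t
  \<comment> \<open>The mean of \<open>f\<close> over that interval, which is the optimal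
    constant.\<close>
  define \<theta> where "\<theta> = 2 * V * real (card A) / (b - a + 2 * V)"
  have pos: "b - a + 2 * V > 0" using assms by simp
  have "(LBINT t. 2 * \<theta> * f t - \<theta>^2 * indicat_real {a - V..b + V} t) \<le> (LBINT t. (f t)^2)"
  proof (rule integral_mono)
    show "integrable lborel (\<lambda>t. (f t)^2)"
      unfolding f_def by (rule integral_card_real_window_squared[OF \<open>finite A\<close>])
    show "integrable lborel (\<lambda>t. 2 * \<theta> * f t - \<theta>^2 * indicat_real {a - V..b + V} t)"
      unfolding f_def using assms(1,2)
      by (intro Bochner_Integration.integrable_diff integrable_mult_right
          integral_card_real_window integral_indicator_Icc) auto
    fix t
    show "2 * \<theta> * f t - \<theta>^2 * indicat_real {a - V..b + V} t \<le> (f t)^2"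
    proof (cases "t \<in> {a - V..b + V}")
      case True
      have "0 \<le> (f t - \<theta>)^2" by simp
      then show ?thesis using True by (simp add: power2_diff mult_ac)
    next
      case False
      then have "real_window A V t = {}" using assms(4) by (force simp: abs_le_iff)
      then show ?thesis using False by (simp only: f_def) simp
    qed
  qed
  also have "(LBINT t. 2 * \<theta> * f t - \<theta>^2 * indicat_real {a - V..b + V} t)
      = 2 * \<theta> * (2 * V * real (card A)) - \<theta>^2 * (b - a + 2 * V)"
    unfolding f_def using assms(1-3) integral_card_real_window[OF assms(1), of V]
    by (subst Bochner_Integration.integral_diff)
       (auto simp: integral_indicator_Icc)
  also have "\<dots> = (2 * V * real (card A))^2 / (b - a + 2 * V)"
  proof -
    have "2 * (X / D) * X - (X / D)^2 * D = X^2 / D" if "D > 0" for X D :: real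
      using that by (simp add: field_simps power2_eq_square)
    from this[OF pos] show ?thesis unfolding \<theta>_def .
  qed
  finally show ?thesis
    using pos by (simp add: f_def field_simps)
qed

section \<open>The sieve bound for windows of real length\<close>

lemma sieve_gram_nat:
  fixes A :: "int set" and \<L> :: "nat \<Rightarrow> int set" and H :: nat and Q :: real
  assumes "finite A" "Q \<ge> 1" "H \<ge> 1"
    and "\<And>p. prime p \<Longrightarrow> real p \<le> Q \<Longrightarrow> \<L> p \<subset> {0..<int p}"
    and "\<And>p n. prime p \<Longrightarrow> real p \<le> Q \<Longrightarrow> n \<in> A \<Longrightarrow> n mod int p \<notin> \<L> p"
  shows "sieve_L \<L> Q * (\<Sum>m\<in>A. \<Sum>n\<in>A. max 0 (real H - \<bar>real_of_int m - real_of_int n\<bar>))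
      \<le> (real H ^ 2 + (2 * real H - 1) * Q ^ 2) * real (card A)"
proof -
  \<comment> \<open>Any bound for the absolute values will do: the starts run from
    \<open>- b - H\<close>, which leaves the margin \<open>H\<close> on the left, up to
    \<open>b\<close>.\<close>
  define b where "b = (\<Sum>n\<in>A. \<bar>n\<bar>)"
  have "\<bar>n\<bar> \<le> b" if "n \<in> A" for n
    unfolding b_def using that \<open>finite A\<close> by (intro member_le_sum) auto
  moreover have "b \<ge> 0" by (simp add: b_def sum_nonneg)
  ultimately have sub: "A \<subseteq> {(- b - int H) + int H..<(- b - int H) + int (nat (2 * b + int H + 1))}"
    by (force simp: abs_le_iff)
  show ?thesis
    unfolding sum_card_window_squared[OF sub, symmetric]
    by (rule sieve_windows[OF assms(2,3) sub _ assms(4,5)]) (use \<open>b \<ge> 0\<close> in auto)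
qed

text \<open>The term \<open>q = 1\<close> equals 1 and the others are nonnegative; this permits
  dividing by the sieve sum.\<close>

lemma sieve_L_ge_1:
  assumes "Q \<ge> 1" and L: "\<And>p. prime p \<Longrightarrow> real p \<le> Q \<Longrightarrow> \<L> p \<subset> {0..<int p}"
  shows "sieve_L \<L> Q \<ge> 1"
proof -
  define g where "g q = real_of_int (moebius_mu q) ^ 2 *
        (\<Prod>p\<in>prime_factors q. real (card (\<L> p)) / (real p - real (card (\<L> p))))" for q
  have "g q \<ge> 0" if q: "q \<in> {q. 1 \<le> q \<and> real q \<le> Q}" for q
    unfolding g_def
  proof (intro mult_nonneg_nonneg prod_nonneg ballI divide_nonneg_nonneg)
    fix p assume "p \<in> prime_factors q"
    then have "prime p" "real p \<le> Q" using q dvd_imp_le[of p q] by (auto simp: in_prime_factors_iff)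
    then have "card (\<L> p) \<le> p" using L[of p] card_mono[of "{0..<int p}" "\<L> p"] by auto
    then show "real p - real (card (\<L> p)) \<ge> 0" by simp
  qed auto
  then have "g 1 \<le> (\<Sum>q | 1 \<le> q \<and> real q \<le> Q. g q)"
    using \<open>Q \<ge> 1\<close> finite_nat_le_real by (intro member_le_sum) auto
  then show ?thesis by (simp add: sieve_L_def g_def moebius_mu_def)
qed

text \<open>Distances between integers are integral, so the Gram sum is linear in \<open>W\<close>
  between consecutive integers, and the bounds at \<open>H\<close> and \<open>H + 1\<close> can be
  interpolated. Convexity of the square costs \<open>\<theta> * (1 - \<theta>)\<close>, which the
  \<open>- 1\<close> in \<open>2 * H - 1\<close> absorbs because
  \<open>Q ^ 2 \<ge> 1\<close>.\<close>

lemma sieve_gram: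
  fixes A :: "int set" and \<L> :: "nat \<Rightarrow> int set" and W Q :: real
  assumes "finite A" "Q \<ge> 1" "W > 0"
    and "\<And>p. prime p \<Longrightarrow> real p \<le> Q \<Longrightarrow> \<L> p \<subset> {0..<int p}"
    and "\<And>p n. prime p \<Longrightarrow> real p \<le> Q \<Longrightarrow> n \<in> A \<Longrightarrow> n mod int p \<notin> \<L> p"
  shows "sieve_L \<L> Q * (\<Sum>m\<in>A. \<Sum>n\<in>A. max 0 (W - \<bar>real_of_int m - real_of_int n\<bar>))
      \<le> (W ^ 2 + 2 * W * Q ^ 2) * real (card A)"
proof -
  define H where "H = nat \<lfloor>W\<rfloor>"
  define \<theta> where "\<theta> = W - real H"
  define S where "S u = (\<Sum>m\<in>A. \<Sum>n\<in>A. max 0 (u - \<bar>real_of_int m - real_of_int n\<bar>))" for u :: real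
  have H: "real H \<le> W" "W < real H + 1" using \<open>W > 0\<close> unfolding H_def by linarith+
  then have \<theta>: "0 \<le> \<theta>" "\<theta> \<le> 1" by (auto simp: \<theta>_def)
  have "max 0 (W - \<bar>real_of_int m - real_of_int n\<bar>)
     = (1 - \<theta>) * max 0 (real H - \<bar>real_of_int m - real_of_int n\<bar>)
       + \<theta> * max 0 (real (Suc H) - \<bar>real_of_int m - real_of_int n\<bar>)" for m n
  proof -
    define d where "d = \<bar>real_of_int m - real_of_int n\<bar>"
    have d: "d = real_of_int \<bar>m - n\<bar>" by (simp add: d_def)
    consider "\<bar>m - n\<bar> \<le> int H" | "\<bar>m - n\<bar> \<ge> int H + 1" by linarith
    then have "d \<le> real H \<or> d \<ge> real H + 1" unfolding d by cases linarith+
    then have "max 0 (W - d) = (1 - \<theta>) * max 0 (real H - d) + \<theta> * max 0 (real (Suc H) - d)"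
    proof
      assume "d \<le> real H"
      then have "max 0 (W - d) = W - d" "max 0 (real H - d) = real H - d" "max 0 (real (Suc H) - d) = real H + 1 - d"
        using H by auto
      then show ?thesis by (simp add: \<theta>_def algebra_simps)
    next
      assume "d \<ge> real H + 1"
      then have "max 0 (W - d) = 0" "max 0 (real H - d) = 0" "max 0 (real (Suc H) - d) = 0"
        using H by auto
      then show ?thesis by simp
    qed
    then show ?thesis by (simp only: d_def)
  qed
  then have S: "S W = (1 - \<theta>) * S (real H) + \<theta> * S (real (Suc H))"
    by (simp only: S_def sum.distrib sum_distrib_left)
  define P where "P = Q ^ 2"
  have P: "P \<ge> 1" using \<open>Q \<ge> 1\<close> by (simp add: P_def)
  have up: "sieve_L \<L> Q * S (real (Suc H)) \<le> (real (Suc H) ^ 2 + (2 * real (Suc H) - 1) * P) * real (card A)"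
    unfolding S_def P_def by (intro sieve_gram_nat assms) auto
  have "sieve_L \<L> Q * S W \<le> (W ^ 2 + 2 * W * P) * real (card A)"
  proof (cases "H = 0")
    case True
    have "max 0 (- \<bar>real_of_int m - real_of_int n\<bar>) = 0" for m n by simp
    then have "S 0 = 0" by (simp add: S_def)
    then have "sieve_L \<L> Q * S W = \<theta> * (sieve_L \<L> Q * S (real (Suc H)))"
      using S True by simp
    also have "\<dots> \<le> \<theta> * ((1 + P) * real (card A))"
      using mult_left_mono[OF up \<theta>(1)] True by simp
    also have "\<dots> \<le> (W ^ 2 + 2 * W * P) * real (card A)"
    proof -
      have "0 \<le> \<theta> * (\<theta> + P - 1)" using \<theta> P by (intro mult_nonneg_nonneg) auto
      then have "\<theta> * (1 + P) \<le> W ^ 2 + 2 * W * P"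
        using True by (simp add: \<theta>_def power2_eq_square algebra_simps)
      then show ?thesis using mult_right_mono[of _ _ "real (card A)"] by (simp add: mult.assoc[symmetric])
    qed
    finally show ?thesis .
  next
    case False
    have lo: "sieve_L \<L> Q * S (real H) \<le> (real H ^ 2 + (2 * real H - 1) * P) * real (card A)"
      unfolding S_def P_def using False by (intro sieve_gram_nat assms) auto
    have "sieve_L \<L> Q * S W = (1 - \<theta>) * (sieve_L \<L> Q * S (real H)) + \<theta> * (sieve_L \<L> Q * S (real (Suc H)))"
      by (simp add: S algebra_simps)
    also have "\<dots> \<le> (1 - \<theta>) * ((real H ^ 2 + (2 * real H - 1) * P) * real (card A))
       + \<theta> * ((real (Suc H) ^ 2 + (2 * real (Suc H) - 1) * P) * real (card A))"
      using \<theta> by (intro add_mono mult_left_mono lo up) auto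
    also have "\<dots> = (W ^ 2 + 2 * W * P - (P - \<theta> * (1 - \<theta>))) * real (card A)"
    proof -
      have "W = real H + \<theta>" by (simp add: \<theta>_def)
      then show ?thesis by (simp add: power2_eq_square algebra_simps)
    qed
    also have "\<dots> \<le> (W ^ 2 + 2 * W * P) * real (card A)"
    proof (intro mult_right_mono)
      have "\<theta> * (1 - \<theta>) \<le> 1 * 1" using \<theta> by (intro mult_mono) auto
      then show "W ^ 2 + 2 * W * P - (P - \<theta> * (1 - \<theta>)) \<le> W ^ 2 + 2 * W * P" using P by linarith
    qed simp
    finally show ?thesis .
  qed
  then show ?thesis by (simp only: S_def P_def)
qed

section \<open>The two bounds for the integral\<close>

theorem corollary1p1:
  fixes M N Q V :: real and \<L> :: "nat \<Rightarrow> int set" and \<Z> :: "int set"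
  assumes "N \<ge> 1"
    and "Q > 0" and "V > 0" and "Q \<le> M" and "V \<le> N / 2" and "Q \<ge> 1"
    and "\<And>p. prime p \<Longrightarrow> real p \<le> Q \<Longrightarrow> \<L> p \<subset> carrier (residue_ring (int p))"
    and "\<Z> = sifted_set \<L> Q M N"
  shows "(1 - 2 * V / N) / N * \<bar>\<Sum>n\<in>\<Z>. 1 :: real\<bar> ^ 2
           \<le> (\<integral>t. \<bar>\<Sum>n | n \<in> \<Z> \<and> \<bar>real_of_int n - t\<bar> \<le> V. 1 :: real\<bar> ^ 2 / (4 * V ^ 2) \<partial>lborel)
       \<and> (\<integral>t. \<bar>\<Sum>n | n \<in> \<Z> \<and> \<bar>real_of_int n - t\<bar> \<le> V. 1 :: real\<bar> ^ 2 / (4 * V ^ 2) \<partial>lborel)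
           \<le> (1 + Q ^ 2 / V) / sieve_L \<L> Q * (\<Sum>n\<in>\<Z>. 1)"
proof -
  have L: "\<L> p \<subset> {0..<int p}" if "prime p" "real p \<le> Q" for p
    using assms(7)[OF that] prime_gt_1_nat[OF that(1)]
    by (auto simp: residue_ring_def)
  have range: "real_of_int n \<in> {M + 1..M + N}" if "n \<in> \<Z>" for n
    using that assms(8) by (simp add: sifted_set_def)
  have fin: "finite \<Z>"
  proof (rule finite_subset)
    show "\<Z> \<subseteq> {\<lfloor>M\<rfloor>..\<lceil>M + N\<rceil>}"
      using range by (force simp: floor_le_iff le_ceiling_iff)
  qed simp
  define I where "I = (LBINT t. real (card (real_window \<Z> V t))^2)"
  have int: "(\<integral>t. \<bar>\<Sum>n | n \<in> \<Z> \<and> \<bar>real_of_int n - t\<bar> \<le> V. 1 :: real\<bar> ^ 2 / (4 * V ^ 2) \<partial>lborel) = I / (4 * V^2)"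
    by (simp add: I_def)
  have "(1 - 2 * V / N) / N * real (card \<Z>)^2 \<le> I / (4 * V^2)"
  proof -
    have I0: "I \<ge> 0" unfolding I_def by (rule Bochner_Integration.integral_nonneg) simp
    have "(2 * V * real (card \<Z>))^2 \<le> (N - 1 + 2 * V) * I"
      using integral_card_real_window_squared_ge[OF fin \<open>V > 0\<close> _ range] \<open>N \<ge> 1\<close> by (simp add: I_def)
    also have "\<dots> \<le> (N + 2 * V) * I" using I0 by (intro mult_right_mono) auto
    finally have "real (card \<Z>)^2 / (N + 2 * V) \<le> I / (4 * V^2)"
      using assms(1,3) by (simp add: field_simps power_mult_distrib)
    \<comment> \<open>This is \<open>(1 - u) * (1 + u) \<le> 1\<close> with
      \<open>u = 2 * V / N\<close>.\<close>
    moreover have "(1 - 2 * V / N) / N \<le> 1 / (N + 2 * V)"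
      using assms(1,3) by (simp add: field_simps)
    then have "(1 - 2 * V / N) / N * real (card \<Z>)^2 \<le> 1 / (N + 2 * V) * real (card \<Z>)^2"
      by (intro mult_right_mono) auto
    ultimately show ?thesis by simp
  qed
  moreover have "I / (4 * V^2) \<le> (1 + Q ^ 2 / V) / sieve_L \<L> Q * real (card \<Z>)"
  proof -
    have Lpos: "sieve_L \<L> Q > 0" using sieve_L_ge_1[OF assms(6) L] by linarith
    \<comment> \<open>The Gram bound is taken at \<open>W = 2 * V\<close>, the length of the real
      windows; its factor \<open>4 * V^2\<close> cancels the normalisation of the integral.\<close>
    have "sieve_L \<L> Q * I \<le> ((2 * V)^2 + 2 * (2 * V) * Q^2) * real (card \<Z>)"
      unfolding I_def integral_card_real_window_squared(1)[OF fin]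
      by (rule sieve_gram) (use fin assms L in \<open>auto simp: sifted_set_def\<close>)
    also have "(2 * V)^2 + 2 * (2 * V) * Q^2 = 4 * V^2 * (1 + Q ^ 2 / V)"
      using \<open>V > 0\<close> by (simp add: field_simps power2_eq_square)
    finally have "I \<le> 4 * V^2 * (1 + Q ^ 2 / V) * real (card \<Z>) / sieve_L \<L> Q"
      using Lpos by (simp add: pos_le_divide_eq mult.commute)
    then have "I / (4 * V^2) \<le> 4 * V^2 * (1 + Q ^ 2 / V) * real (card \<Z>) / sieve_L \<L> Q / (4 * V^2)"
      by (rule divide_right_mono) simp
    then show ?thesis using \<open>V > 0\<close> by simp
  qed
  ultimately show ?thesis unfolding int by simp
qed

end
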